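(* Let $(\mathcal{A},\mathcal{B})$ be a generalized $\mathcal{M}$-tensor pair, with $\mathcal{A},\mathcal{B}\in T_{m,n}$. Then there exists a positive eigenpair for the tensor pair $(\mathcal{A},\mathcal{B}-\mathcal{A})$, i.e. there exist a real number $s>0$ and a vector $\mathbf{x}_*\in\mathbb{R}^n$, $\mathbf{x}_*>0$, such that $\mathcal{A}\mathbf{x}_*^{m-1}=s(\mathcal{B}-\mathcal{A})\mathbf{x}_*^{m-1}$.
   Context: Let $m,n\ge 2$. $T_{m,n}$ is the set of real tensors $\mathcal{A}=(a_{i_1\ldots i_m})$ with $i_1,\ldots,i_m\in\{1,\ldots,n\}$. For $\mathbf{x}\in\mathbb{R}^n$, $\mathcal{A}\mathbf{x}^{m-1}\in\mathbb{R}^n$ is the vector with $i$-th entry $\sum_{i_2,\ldots,i_m=1}^n a_{ii_2\cdots i_m}x_{i_2}\cdots x_{i_m}$. Inequalities between vectors or tensors are entrywise. $\mathcal{A}$ is weakly irreducible if for every nonempty proper subset $S\subset\{1,\ldots,n\}$ there exist $i_1\in S$ and $i_2,\ldots,i_m$ with at least one $i_q\notin S$ ($2\le q\le m$) such that $a_{i_1i_2\ldots i_m}\ne0$. $(\mathcal{A},\mathcal{B})$ is a generalized $\mathcal{M}$-tensor pair if: (1) $\mathcal{A}\ge 0$; (2) $\mathcal{A}$ is weakly irreducible; (3) there is $\mathbf{v}\in\mathbb{R}^n$, $\mathbf{v}>0$, with $\mathcal{B}\mathbf{v}^{m-1}>\mathcal{A}\mathbf{v}^{m-1}$; (4) $b_{ii_2\ldots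 i_m}\le a_{ii_2\ldots i_m}$ for all $i$ and all $(i_2,\ldots,i_m)\ne(i,\ldots,i)$. *)

theory Defs
  imports "HOL-Analysis.Analysis"
begin

text \<open>
  The index set \<open>{1,...,n}\<close> is a finite type \<open>'n\<close> with \<open>CARD('n) = n\<close>. A tensor of order \<open>m\<close>
  is a function on index tuples, represented as lists of length \<open>m\<close>; it is fixed to 0 on
  lists of any other length, so that each tensor has exactly one representative.
\<close>

type_synonym 'n tensor = "'n list \<Rightarrow> real"

definition tensors :: "nat \<Rightarrow> ('n::finite) tensor set" where
  "tensors m = {A. \<forall>is. length is \<noteq> m \<longrightarrow> A is = 0}"

text \<open>The vector \<open>A x\<close> to the power \<open>m - 1\<close>; the list \<open>js\<close> stands for \<open>(i_2,...,i_m)\<close>.\<close>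

definition tensor_apply :: "nat \<Rightarrow> ('n::finite) tensor \<Rightarrow> real ^ 'n \<Rightarrow> real ^ 'n" where
  "tensor_apply m A x =
     (\<chi> i. \<Sum>js | length js = m - 1. A (i # js) * (\<Prod>j\<leftarrow>js. x $ j))"

definition weakly_irreducible :: "nat \<Rightarrow> ('n::finite) tensor \<Rightarrow> bool" where
  "weakly_irreducible m A \<longleftrightarrow>
     (\<forall>S. S \<noteq> {} \<and> S \<noteq> UNIV \<longrightarrow>
        (\<exists>i\<in>S. \<exists>js. length js = m - 1 \<and> (\<exists>j\<in>set js. j \<notin> S) \<and> A (i # js) \<noteq> 0))"

text \<open>
  Strict inequalities between vectors are written out entrywise: the library order \<open><\<close> on
  \<open>real ^ 'n\<close> only asks for \<open>\<le>\<close> in every entry and strictness in some entry.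
\<close>

definition generalized_M_tensor_pair ::
    "nat \<Rightarrow> ('n::finite) tensor \<Rightarrow> 'n tensor \<Rightarrow> bool" where
  "generalized_M_tensor_pair m A B \<longleftrightarrow>
     (\<forall>is. length is = m \<longrightarrow> 0 \<le> A is) \<and>
     weakly_irreducible m A \<and>
     (\<exists>v. (\<forall>i. 0 < v $ i) \<and> (\<forall>i. tensor_apply m A v $ i < tensor_apply m B v $ i)) \<and>
     (\<forall>i js. length js = m - 1 \<and> js \<noteq> replicate (m - 1) i \<longrightarrow> B (i # js) \<le> A (i # js))"

end

theory Submission
  imports Defs
begin

text \<open>
  Put \<open>C = B - A\<close>; its entries off the diagonal are nonpositive. It is enough to find \<open>l > 0\<close> and
  \<open>x > 0\<close> with \<open>C x = l A x\<close> (abbreviating the vectors \<open>C x^(m-1)\<close> and \<open>A x^(m-1)\<close>), for then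
  \<open>s = 1/l\<close>. The argument is of Collatz--Wielandt type: among all
  \<open>l\<close> that admit an \<open>x > 0\<close> with \<open>C x \<ge> l A x\<close>, a subeigenvector for \<open>l\<close>, the largest \<open>l\<close> is
  an eigenvalue.

  Some \<open>l > 0\<close> is admissible, since \<open>C v > 0\<close> leaves room for a small multiple of \<open>A v\<close>. That
  the supremum is attained by a strictly positive vector
  (\<open>largest_subeigenvalue_attained\<close>) is a matter of compactness, and here weak
  irreducibility enters for the first time. A limit of subeigenvectors with largest entry 1 may well
  have zero entries, because a monomial is small as soon as one of its factors is. With
  smallest entry 1 no factor is below 1, so a monomial dominates each of its factors, and a bound
  on \<open>x_i\<close> yields a bound on every \<open>x_j\<close> that occurs in row \<open>i\<close> of \<open>A\<close>. By weak irreducibility the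
  bound spreads from a smallest entry to all entries
  (\<open>normalised_subeigenvectors_bounded\<close>).

  At the largest \<open>l\<close>, take a subeigenvector with the fewest tight rows, a row \<open>i\<close> being
  tight if \<open>(C x)_i = l (A x)_i\<close>. If no row is tight, \<open>l\<close> can be increased. If some but not all
  rows are tight, slightly shrinking the entries of \<open>x\<close> at the other rows keeps those rows strict
  and, by weak irreducibility, makes one of the tight rows strict (\<open>fewer_tight_rows\<close>). So all
  rows are tight, which is the eigenvalue equation.
\<close>

section \<open>Monomials indexed by lists\<close>

lemma finite_index_lists: "finite {js :: ('n::finite) list. length js = k}"
  using finite_lists_length_eq[of "UNIV :: 'n set" k] by simp

lemma prod_list_map_pos:
  fixes f :: "'a \<Rightarrow> real"
  assumes "\<And>j. 0 < f j"
  shows "0 < (\<Prod>j\<leftarrow>js. f j)"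
  using assms by (induction js) auto

lemma prod_list_map_mono:
  fixes f g :: "'a \<Rightarrow> real"
  assumes "\<And>j. 0 < f j" and "\<And>j. f j \<le> g j"
  shows "(\<Prod>j\<leftarrow>js. f j) \<le> (\<Prod>j\<leftarrow>js. g j)"
proof (induction js)
  case (Cons a js)
  have "0 \<le> g a" using assms[of a] by linarith
  then show ?case
    using Cons assms prod_list_map_pos[of f js] by (simp add: mult_mono less_imp_le)
qed simp

lemma prod_list_map_strict_mono:
  fixes f g :: "'a \<Rightarrow> real"
  assumes pos: "\<And>j. 0 < f j" and le: "\<And>j. f j \<le> g j"
    and "k \<in> set js" and "f k < g k"
  shows "(\<Prod>j\<leftarrow>js. f j) < (\<Prod>j\<leftarrow>js. g j)"
  using assms(3)
proof (induction js)
  case (Cons a js)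
  have fp: "0 < (\<Prod>j\<leftarrow>js. f j)" by (rule prod_list_map_pos[OF pos])
  have ga: "0 < g a" using pos[of a] le[of a] by linarith
  show ?case
  proof (cases "a = k")
    case True
    have "f a * (\<Prod>j\<leftarrow>js. f j) < g a * (\<Prod>j\<leftarrow>js. f j)"
      using fp True assms(4) by simp
    also have "\<dots> \<le> g a * (\<Prod>j\<leftarrow>js. g j)"
      using ga prod_list_map_mono[OF pos le] by (simp add: mult_left_mono)
    finally show ?thesis by simp
  next
    case False
    then have IH: "(\<Prod>j\<leftarrow>js. f j) < (\<Prod>j\<leftarrow>js. g j)" using Cons by simp
    have "f a * (\<Prod>j\<leftarrow>js. f j) \<le> g a * (\<Prod>j\<leftarrow>js. f j)"
      using fp le by (simp add: mult_right_mono)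
    also have "\<dots> < g a * (\<Prod>j\<leftarrow>js. g j)" using ga IH by simp
    finally show ?thesis by simp
  qed
qed simp

lemma prod_list_map_ge_one:
  fixes f :: "'a \<Rightarrow> real"
  assumes "\<And>j. 1 \<le> f j"
  shows "1 \<le> (\<Prod>j\<leftarrow>js. f j)"
proof (induction js)
  case (Cons a js)
  then show ?case using mult_mono[of 1 "f a" 1] assms[of a] by force
qed simp

lemma factor_le_prod_list_map:
  fixes f :: "'a \<Rightarrow> real"
  assumes ge: "\<And>j. 1 \<le> f j" and "k \<in> set js"
  shows "f k \<le> (\<Prod>j\<leftarrow>js. f j)"
  using assms(2)
proof (induction js)
  case (Cons a js)
  have p: "1 \<le> (\<Prod>j\<leftarrow>js. f j)" by (rule prod_list_map_ge_one[OF ge])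
  show ?case
  proof (cases "a = k")
    case True
    then show ?thesis using mult_left_mono[OF p, of "f k"] ge[of k] by simp
  next
    case False
    then have "f k \<le> (\<Prod>j\<leftarrow>js. f j)" using Cons by simp
    also have "\<dots> \<le> f a * (\<Prod>j\<leftarrow>js. f j)"
      using mult_right_mono[OF ge[of a], of "\<Prod>j\<leftarrow>js. f j"] p by simp
    finally show ?thesis by simp
  qed
qed simp

lemma tensor_apply_scaleR:
  "tensor_apply m A (c *\<^sub>R x) $ i = c ^ (m - 1) * tensor_apply m A x $ i"
proof -
  have *: "(\<Prod>j\<leftarrow>js. c * x $ j) = c ^ length js * (\<Prod>j\<leftarrow>js. x $ j)" for js
    by (induction js) (auto simp: algebra_simps)
  show ?thesis
    by (auto simp: tensor_apply_def * sum_distrib_left algebra_simps intro!: sum.cong)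
qed

lemma tensor_apply_diff:
  "tensor_apply m (B - A) x = tensor_apply m B x - tensor_apply m A x"
  by (simp add: tensor_apply_def vec_eq_iff sum_subtractf left_diff_distrib)

lemma continuous_on_tensor_apply [continuous_intros]:
  assumes "continuous_on S f"
  shows "continuous_on S (\<lambda>t. tensor_apply m A (f t) $ i)"
proof -
  have "continuous_on S (\<lambda>t. \<Prod>j\<leftarrow>js. f t $ j)" for js
    by (induction js) (auto intro!: continuous_intros assms)
  then show ?thesis
    by (auto simp: tensor_apply_def intro!: continuous_intros)
qed

section \<open>Subeigenvectors of a pair\<close>

text \<open>
  The sign pattern of a generalized M-tensor pair in terms of \<open>A\<close> and \<open>C = B - A\<close>: the only
  entries of \<open>C\<close> that can be positive are the diagonal ones, as for Z-matrices.
\<close>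

locale nonneg_Z_pair =
  fixes m :: nat and A C :: "('n::finite) tensor"
  assumes A_nonneg: "length js = m - 1 \<Longrightarrow> 0 \<le> A (i # js)"
    and C_offdiag: "length js = m - 1 \<Longrightarrow> js \<noteq> replicate (m - 1) i \<Longrightarrow> C (i # js) \<le> 0"
    and irreducible: "weakly_irreducible m A"
begin

text \<open>
  A vector \<open>x > 0\<close> with \<open>gap l x i \<ge> 0\<close> for all \<open>i\<close> is a subeigenvector for \<open>l\<close>, an eigenvector if
  all gaps vanish.
\<close>

definition gap :: "real \<Rightarrow> real ^ 'n \<Rightarrow> 'n \<Rightarrow> real" where
  "gap l x i = tensor_apply m C x $ i - l * tensor_apply m A x $ i"

lemma gap_eq_sum:
  "gap l x i =
     (\<Sum>js | length js = m - 1. (C (i # js) - l * A (i # js)) * (\<Prod>j\<leftarrow>js. x $ j))"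
  by (simp add: gap_def tensor_apply_def sum_distrib_left left_diff_distrib
      sum_subtractf mult.assoc)

lemma gap_scaleR: "gap l (c *\<^sub>R x) i = c ^ (m - 1) * gap l x i"
  by (simp add: gap_def tensor_apply_scaleR algebra_simps)

lemma continuous_on_gap [continuous_intros]:
  assumes "continuous_on S f" and "continuous_on S g"
  shows "continuous_on S (\<lambda>t. gap (f t) (g t) i)"
  unfolding gap_def by (intro continuous_intros assms)

lemma eventually_gap_pos:
  assumes "continuous_on UNIV f" and "continuous_on UNIV g" and "0 < gap (f 0) (g 0) i"
  shows "\<forall>\<^sub>F t::real in at_right 0. 0 < gap (f t) (g t) i"
proof -
  have "continuous_on UNIV (\<lambda>t. gap (f t) (g t) i)"
    by (intro continuous_intros assms)
  then have "((\<lambda>t. gap (f t) (g t) i) \<longlongrightarrow> gap (f 0) (g 0) i) (at_right 0)"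
    by (meson UNIV_I continuous_on_def tendsto_within_subset subset_UNIV)
  then show ?thesis using assms(3) by (rule order_tendstoD)
qed

lemma larger_subeigenvalue_if_gap_pos:
  assumes "\<And>i. 0 < gap l x i"
  shows "\<exists>l'>l. \<forall>i. 0 \<le> gap l' x i"
proof -
  have "\<forall>\<^sub>F t::real in at_right 0. \<forall>i. 0 < gap (l + t) x i"
    by (intro eventually_all_finite eventually_gap_pos[of "\<lambda>t. l + t" "\<lambda>t. x"])
       (auto intro!: continuous_intros assms)
  then have "\<forall>\<^sub>F t::real in at_right 0. (\<forall>i. 0 < gap (l + t) x i) \<and> 0 < t"
    by (intro eventually_conj eventually_at_right_less)
  then obtain t where "\<forall>i. 0 < gap (l + t) x i" "0 < t"
    using eventually_happens[of _ "at_right (0::real)"] by (auto simp: trivial_limit_at_right_real)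
  then show ?thesis by (intro exI[of _ "l + t"]) (auto simp: less_imp_le)
qed

text \<open>
  All terms of row \<open>i\<close> except the diagonal one of \<open>C\<close> contribute nonpositively to the gap, so the
  diagonal term must outweigh each of them separately. All a priori bounds come from this.
\<close>

lemma monomial_le_diagonal:
  assumes l: "0 \<le> l" and x: "\<And>j. 0 < x $ j" and gap: "0 \<le> gap l x i"
    and js: "length js = m - 1"
  shows "l * A (i # js) * (\<Prod>j\<leftarrow>js. x $ j) \<le> C (i # replicate (m - 1) i) * x $ i ^ (m - 1)"
proof -
  let ?L = "{js :: 'n list. length js = m - 1}"
  have mono: "0 \<le> (\<Prod>j\<leftarrow>ks. x $ j)" for ks
    using prod_list_map_pos[of "\<lambda>j. x $ j" ks] x by simp
  have "A (i # js) * (\<Prod>j\<leftarrow>js. x $ j) \<le> tensor_apply m A x $ i"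
    unfolding tensor_apply_def vec_lambda_beta
    using member_le_sum[of js ?L "\<lambda>js. A (i # js) * (\<Prod>j\<leftarrow>js. x $ j)"]
      finite_index_lists[of "m - 1", where 'n = 'n] js A_nonneg mono by simp
  then have "l * A (i # js) * (\<Prod>j\<leftarrow>js. x $ j) \<le> l * tensor_apply m A x $ i"
    using l by (simp add: mult_left_mono mult.assoc)
  also have "\<dots> \<le> tensor_apply m C x $ i" using gap by (simp add: gap_def)
  also have "\<dots> = C (i # replicate (m - 1) i) * (\<Prod>j\<leftarrow>replicate (m - 1) i. x $ j)
      + (\<Sum>js \<in> ?L - {replicate (m - 1) i}. C (i # js) * (\<Prod>j\<leftarrow>js. x $ j))"
    unfolding tensor_apply_def vec_lambda_beta
    by (subst sum.remove[of _ "replicate (m - 1) i"]) (auto simp: finite_index_lists)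
  also have "\<dots> \<le> C (i # replicate (m - 1) i) * (\<Prod>j\<leftarrow>replicate (m - 1) i. x $ j)"
  proof -
    have "(\<Sum>js \<in> ?L - {replicate (m - 1) i}. C (i # js) * (\<Prod>j\<leftarrow>js. x $ j)) \<le> 0"
      using C_offdiag mono by (intro sum_nonpos mult_nonpos_nonneg) auto
    then show ?thesis by linarith
  qed
  finally show ?thesis by (simp add: prod_list_replicate)
qed

lemma entry_bounds:
  obtains a c where "0 < a" and "0 < c"
    and "\<And>i js. length js = m - 1 \<Longrightarrow> A (i # js) \<noteq> 0 \<Longrightarrow> a \<le> A (i # js)"
    and "\<And>i. C (i # replicate (m - 1) i) \<le> c"
proof -
  \<comment> \<open>The inserted 1 keeps the two sets nonempty and the maximum positive.\<close>
  let ?V = "insert 1 ((\<lambda>(i, js). A (i # js)) `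
      {p \<in> UNIV \<times> {js. length js = m - 1}. A (fst p # snd p) \<noteq> 0})"
  let ?W = "insert 1 (range (\<lambda>i. C (i # replicate (m - 1) i)))"
  have V: "finite ?V"
    by (intro finite.insertI finite_imageI
        finite_subset[OF _ finite_cartesian_product[OF finite finite_index_lists]]) auto
  show ?thesis
  proof
    have "\<forall>y\<in>?V. 0 < y"
      using A_nonneg by (auto simp: order.strict_iff_order)
    then show "0 < Min ?V" using V by (subst Min_gr_iff) auto
    show "0 < Max ?W" by (subst Max_gr_iff) auto
    show "Min ?V \<le> A (i # js)" if "length js = m - 1" "A (i # js) \<noteq> 0" for i js
      using that by (intro Min_le V) force
    show "C (i # replicate (m - 1) i) \<le> Max ?W" for i
      by (intro Max_ge) auto
  qed
qed

text \<open>
  If \<open>M\<close> bounds some but not all entries, weak irreducibility gives a row \<open>i\<close> with \<open>x $ i \<le> M\<close> and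
  a nonzero \<open>A (i # js)\<close> with some \<open>x $ j > M\<close>, \<open>j \<in> set js\<close>. Comparing the monomial of \<open>js\<close> with the
  diagonal term bounds \<open>x $ j\<close> by a constant multiple of \<open>M ^ (m - 1)\<close>. So each enlargement of
  \<open>M\<close> captures at least one more entry. The constant involves \<open>1 / l0\<close>; thus the bound is uniform
  only for \<open>l\<close> away from 0.
\<close>

lemma normalised_subeigenvectors_bounded:
  assumes l0: "0 < l0"
  shows "\<exists>M\<ge>1. \<forall>l x. l0 \<le> l \<longrightarrow> (\<forall>i. 1 \<le> x $ i) \<longrightarrow> (\<exists>i. x $ i = 1) \<longrightarrow>
     (\<forall>i. 0 \<le> gap l x i) \<longrightarrow> (\<forall>i. x $ i \<le> M)"
proof -
  obtain a c where a: "0 < a" and c: "0 < c"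
    and aA: "\<And>i js. length js = m - 1 \<Longrightarrow> A (i # js) \<noteq> 0 \<Longrightarrow> a \<le> A (i # js)"
    and cC: "\<And>i. C (i # replicate (m - 1) i) \<le> c"
    using entry_bounds by blast
  have "\<exists>M\<ge>1. \<forall>l x. l0 \<le> l \<longrightarrow> (\<forall>i. 1 \<le> x $ i) \<longrightarrow> (\<exists>i. x $ i = 1) \<longrightarrow>
     (\<forall>i. 0 \<le> gap l x i) \<longrightarrow> {i. x $ i \<le> M} = UNIV \<or> k < card {i. x $ i \<le> M}" for k
  proof (induction k)
    case 0
    show ?case
      by (intro exI[of _ 1]) (simp add: card_gt_0_iff, metis order_refl)
  next
    case (Suc k)
    then obtain M where M: "1 \<le> M" and
      IH: "\<And>l x. \<lbrakk>l0 \<le> l; \<forall>i. 1 \<le> x $ i; \<exists>i. x $ i = 1; \<forall>i. 0 \<le> gap l x i\<rbrakk>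
        \<Longrightarrow> {i. x $ i \<le> M} = UNIV \<or> k < card {i. x $ i \<le> M}" by blast
    define M' where "M' = max M (c * M ^ (m - 1) / (l0 * a))"
    show ?case
    proof (intro exI[of _ M'] conjI allI impI)
      show "1 \<le> M'" using M by (simp add: M'_def)
      fix l and x :: "real ^ 'n"
      assume l: "l0 \<le> l" and x: "\<forall>i. 1 \<le> x $ i" and one: "\<exists>i. x $ i = 1"
        and gap: "\<forall>i. 0 \<le> gap l x i"
      let ?S = "{i. x $ i \<le> M}" and ?S' = "{i. x $ i \<le> M'}"
      have sub: "?S \<subseteq> ?S'" by (auto simp: M'_def)
      show "?S' = UNIV \<or> Suc k < card ?S'"
      proof (cases "?S = UNIV")
        case True
        then show ?thesis using sub by blast
      next
        case False
        obtain q where "x $ q = 1" using one by blast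
        then have "q \<in> ?S" using M by simp
        then have "?S \<noteq> {}" by blast
        then have "\<exists>i\<in>?S. \<exists>js. length js = m - 1 \<and> (\<exists>j\<in>set js. j \<notin> ?S) \<and> A (i # js) \<noteq> 0"
          using irreducible[unfolded weakly_irreducible_def, rule_format, of ?S] False by simp
        then obtain i js j where i: "x $ i \<le> M" and js: "length js = m - 1"
          and j: "j \<in> set js" "j \<notin> ?S" and A: "A (i # js) \<noteq> 0"
          by blast
        have xp: "0 < x $ j" for j using x less_le_trans[OF zero_less_one] by blast
        \<comment> \<open>All entries are at least 1, so a monomial dominates each of its factors.\<close>
        have "(l0 * a) * x $ j \<le> (l * A (i # js)) * (\<Prod>j\<leftarrow>js. x $ j)"
        proof (intro mult_mono)
          show "x $ j \<le> (\<Prod>j\<leftarrow>js. x $ j)"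
            using factor_le_prod_list_map[of "\<lambda>j. x $ j" j js] x j by blast
        qed (use l l0 a aA[OF js A] xp[of j] in auto)
        also have "\<dots> \<le> C (i # replicate (m - 1) i) * x $ i ^ (m - 1)"
          using monomial_le_diagonal[of l x i js] l l0 xp gap js by simp
        also have "\<dots> \<le> c * M ^ (m - 1)"
          using cC[of i] c i xp[of i] by (intro mult_mono power_mono) auto
        finally have "x $ j \<le> c * M ^ (m - 1) / (l0 * a)"
          using l0 a by (simp add: field_simps)
        then have "j \<in> ?S'" by (simp add: M'_def)
        then have "?S \<subset> ?S'" using sub j by blast
        then have "card ?S < card ?S'" by (intro psubset_card_mono) auto
        then show ?thesis using IH[OF l x one gap] False by linarith
      qed
    qed
  qed
  \<comment> \<open>More than \<open>CARD('n)\<close> entries cannot be captured, so the first alternative holds.\<close>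
  from this[of "CARD('n)"] obtain M where M: "1 \<le> M" and
    *: "\<And>l x. \<lbrakk>l0 \<le> l; \<forall>i. 1 \<le> x $ i; \<exists>i. x $ i = 1; \<forall>i. 0 \<le> gap l x i\<rbrakk>
        \<Longrightarrow> {i. x $ i \<le> M} = UNIV \<or> CARD('n) < card {i. x $ i \<le> M}" by blast
  have "\<not> CARD('n) < card {i. x $ i \<le> M}" for x :: "real ^ 'n"
    by (simp add: card_mono not_less)
  then show ?thesis using M * by blast
qed

text \<open>
  As soon as there are two indices, weak irreducibility for a singleton shows that a row of \<open>A\<close> does
  not vanish; the corresponding monomial is at least 1, which limits \<open>l\<close>.
\<close>

lemma subeigenvalue_bounded:
  assumes n: "2 \<le> CARD('n)" and M: "1 \<le> M"
  shows "\<exists>L. \<forall>l x. 0 \<le> l \<longrightarrow> (\<forall>i. 1 \<le> x $ i \<and> x $ i \<le> M) \<longrightarrow>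
     (\<forall>i. 0 \<le> gap l x i) \<longrightarrow> l \<le> L"
proof -
  obtain a c where a: "0 < a" and c: "0 < c"
    and aA: "\<And>i js. length js = m - 1 \<Longrightarrow> A (i # js) \<noteq> 0 \<Longrightarrow> a \<le> A (i # js)"
    and cC: "\<And>i. C (i # replicate (m - 1) i) \<le> c"
    using entry_bounds by blast
  fix i :: 'n
  have "{i} \<noteq> UNIV" using n card_1_singleton_iff[of "UNIV :: 'n set"] by auto
  then obtain js where js: "length js = m - 1" and A: "A (i # js) \<noteq> 0"
    using irreducible unfolding weakly_irreducible_def by blast
  show ?thesis
  proof (intro exI[of _ "c * M ^ (m - 1) / a"] allI impI)
    fix l and x :: "real ^ 'n"
    assume l: "0 \<le> l" and x: "\<forall>i. 1 \<le> x $ i \<and> x $ i \<le> M" and gap: "\<forall>i. 0 \<le> gap l x i"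
    have xp: "0 < x $ j" for j using x less_le_trans[OF zero_less_one] by blast
    have "(l * a) * 1 \<le> (l * A (i # js)) * (\<Prod>j\<leftarrow>js. x $ j)"
      using aA[OF js A] l a prod_list_map_ge_one[of "\<lambda>j. x $ j" js] x
      by (intro mult_mono) auto
    also have "\<dots> \<le> C (i # replicate (m - 1) i) * x $ i ^ (m - 1)"
      using monomial_le_diagonal[of l x i js] l xp gap js by simp
    also have "\<dots> \<le> c * M ^ (m - 1)"
      using cC[of i] c x xp[of i] by (intro mult_mono power_mono) auto
    finally show "l \<le> c * M ^ (m - 1) / a" using a by (simp add: field_simps)
  qed
qed

lemma largest_subeigenvalue_attained:
  assumes n: "2 \<le> CARD('n)" and l0: "0 < l0"
    and v: "\<And>i. 0 < v $ i" "\<And>i. 0 \<le> gap l0 v i"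
  obtains l x where "l0 \<le> l" and "\<And>i. 0 < x $ i" and "\<And>i. 0 \<le> gap l x i"
    and "\<And>l' y. \<lbrakk>\<And>i. 0 < y $ i; \<And>i. 0 \<le> gap l' y i\<rbrakk> \<Longrightarrow> l' \<le> l"
proof -
  obtain M where M: "1 \<le> M"
    and bound: "\<And>l x. \<lbrakk>l0 \<le> l; \<forall>i. 1 \<le> x $ i; \<exists>i. x $ i = 1; \<forall>i. 0 \<le> gap l x i\<rbrakk>
      \<Longrightarrow> \<forall>i. x $ i \<le> M"
    using normalised_subeigenvectors_bounded[OF l0] by blast
  obtain L where L: "\<And>l x. \<lbrakk>0 \<le> l; \<forall>i. 1 \<le> x $ i \<and> x $ i \<le> M; \<forall>i. 0 \<le> gap l x i\<rbrakk> \<Longrightarrow> l \<le> L"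
    using subeigenvalue_bounded[OF n M] by blast
  define K where "K = ({l0..L} \<times> cbox (\<chi> i. 1) (\<chi> i. M)) \<inter>
      (\<Inter>i. {p. 0 \<le> gap (fst p) (snd p) i})"
  \<comment> \<open>By homogeneity every subeigenvector for some \<open>l \<ge> l0\<close> can be divided by its smallest entry,
    so the compact set \<open>K\<close> captures every such \<open>l\<close>.\<close>
  have normalise: "\<exists>x. (l, x) \<in> K"
    if y: "\<And>i. 0 < y $ i" "\<And>i. 0 \<le> gap l y i" and l: "l0 \<le> l" for l y
  proof -
    define c where "c = Min (range (\<lambda>i. y $ i))"
    have "c \<in> range (\<lambda>i. y $ i)" unfolding c_def by (intro Min_in) auto
    then obtain k where k: "c = y $ k" by blast
    then have c: "0 < c" using y by simp
    have le: "c \<le> y $ i" for i unfolding c_def by (intro Min_le) auto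
    define x where "x = (1 / c) *\<^sub>R y"
    have x: "\<forall>i. 1 \<le> x $ i" "\<exists>i. x $ i = 1" "\<forall>i. 0 \<le> gap l x i"
    proof -
      show "\<forall>i. 1 \<le> x $ i" using c le by (simp add: x_def)
      show "\<exists>i. x $ i = 1" using c k by (intro exI[of _ k]) (simp add: x_def)
      show "\<forall>i. 0 \<le> gap l x i" using c y by (simp add: x_def gap_scaleR)
    qed
    have "\<forall>i. x $ i \<le> M" using bound[OF l x] .
    moreover from this have "l \<le> L" using L[of l x] x l l0 by auto
    ultimately show ?thesis using x l by (auto simp: K_def mem_box_cart)
  qed
  have "closed (\<Inter>i. {p. 0 \<le> gap (fst p) (snd p) i})"
    by (intro closed_INT ballI closed_Collect_le continuous_intros)
  then have K: "compact K" unfolding K_def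
    by (intro compact_Int_closed compact_Times) auto
  have "K \<noteq> {}" using normalise[of v l0] v by auto
  moreover have "continuous_on K (fst :: real \<times> (real ^ 'n) \<Rightarrow> real)"
    by (intro continuous_intros)
  ultimately obtain p where p: "p \<in> K" and max: "\<forall>q\<in>K. fst q \<le> fst p"
    using continuous_attains_sup[OF K, of fst] by blast
  show ?thesis
  proof
    show "l0 \<le> fst p" using p by (auto simp: K_def)
    show "0 < snd p $ i" for i
    proof -
      have "1 \<le> snd p $ i" using p by (auto simp: K_def mem_box_cart)
      then show ?thesis by linarith
    qed
    show "0 \<le> gap (fst p) (snd p) i" for i using p by (auto simp: K_def)
    show "l' \<le> fst p" if y: "\<And>i. 0 < y $ i" "\<And>i. 0 \<le> gap l' y i" for l' y
    proof (cases "l0 \<le> l'")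
      case True
      then show ?thesis using normalise[OF y] max by force
    next
      case False
      then show ?thesis using p by (auto simp: K_def)
    qed
  qed
qed

text \<open>
  Decreasing entries outside \<open>S\<close> leaves the diagonal term of a row in \<open>S\<close> unchanged, and all the
  other coefficients of that row are nonpositive, so its gap cannot decrease. It increases
  strictly in the row that weak irreducibility links to the complement of \<open>S\<close>. The rows outside
  \<open>S\<close> stay strict by continuity if the change is small.
\<close>

lemma fewer_tight_rows:
  assumes l: "0 < l" and x: "\<And>i. 0 < x $ i" and gap: "\<And>i. 0 \<le> gap l x i"
    and S: "S = {i. gap l x i = 0}" "S \<noteq> {}" "S \<noteq> UNIV"
  shows "\<exists>y. (\<forall>i. 0 < y $ i) \<and> (\<forall>i. 0 \<le> gap l y i) \<and> {i. gap l y i = 0} \<subset> S"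
proof -
  define w where "w = (\<chi> j. if j \<in> S then 0 else x $ j)"
  have "\<forall>\<^sub>F t::real in at_right 0. \<forall>i. i \<notin> S \<longrightarrow> 0 < gap l (x - t *\<^sub>R w) i"
  proof (intro eventually_all_finite)
    fix i
    show "\<forall>\<^sub>F t in at_right 0. i \<notin> S \<longrightarrow> 0 < gap l (x - t *\<^sub>R w) i"
    proof (cases "i \<in> S")
      case False
      then have "0 < gap l x i" using gap[of i] S(1) by auto
      then have "\<forall>\<^sub>F t in at_right 0. 0 < gap l (x - t *\<^sub>R w) i"
        by (intro eventually_gap_pos[of "\<lambda>t. l" "\<lambda>t. x - t *\<^sub>R w"])
           (auto intro!: continuous_intros)
      then show ?thesis by (rule eventually_mono) simp
    qed simp
  qed
  moreover have "\<forall>\<^sub>F t::real in at_right 0. 0 < t \<and> t < 1"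
    unfolding eventually_at_right_field by (rule exI[of _ 1]) simp
  ultimately have "\<forall>\<^sub>F t::real in at_right 0.
      (\<forall>i. i \<notin> S \<longrightarrow> 0 < gap l (x - t *\<^sub>R w) i) \<and> 0 < t \<and> t < 1"
    by (rule eventually_conj)
  then obtain t where t: "0 < t" "t < 1" and slack: "\<And>i. i \<notin> S \<Longrightarrow> 0 < gap l (x - t *\<^sub>R w) i"
    using eventually_happens[of _ "at_right (0::real)"] by (auto simp: trivial_limit_at_right_real)
  define y where "y = x - t *\<^sub>R w"
  have y_in: "y $ j = x $ j" if "j \<in> S" for j using that by (simp add: y_def w_def)
  have y_out: "y $ j = (1 - t) * x $ j" if "j \<notin> S" for j
    using that by (simp add: y_def w_def algebra_simps)
  have y: "0 < y $ j" for j using x[of j] t by (cases "j \<in> S") (auto simp: y_in y_out)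
  have lt: "y $ j < x $ j" if "j \<notin> S" for j
    using that x[of j] t by (simp add: y_out)
  have le: "y $ j \<le> x $ j" for j using lt[of j] y_in[of j] by (cases "j \<in> S") auto
  let ?c = "\<lambda>i js. C (i # js) - l * A (i # js)"
  let ?p = "\<lambda>z js. \<Prod>j\<leftarrow>js. z $ j"
  have term_le: "?c i js * ?p x js \<le> ?c i js * ?p y js"
    if i: "i \<in> S" and js: "length js = m - 1" for i js
  proof (cases "js = replicate (m - 1) i")
    case True
    then have "?p x js = ?p y js" using y_in[OF i] by simp
    then show ?thesis by simp
  next
    case False
    then have "?c i js \<le> 0"
      using C_offdiag[OF js False] mult_nonneg_nonneg[OF less_imp_le[OF l] A_nonneg[OF js, of i]]
      by linarith
    moreover have "?p y js \<le> ?p x js" by (rule prod_list_map_mono[OF y le])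
    ultimately show ?thesis by (rule mult_left_mono_neg[rotated])
  qed
  have tight: "0 \<le> gap l y i" if "i \<in> S" for i
  proof -
    have "gap l x i \<le> gap l y i" unfolding gap_eq_sum
      using term_le[OF that] by (intro sum_mono) auto
    then show ?thesis using that S(1) by simp
  qed
  obtain i js j where i: "i \<in> S" and js: "length js = m - 1" and j: "j \<in> set js" "j \<notin> S"
    and A: "A (i # js) \<noteq> 0"
    using irreducible S(2,3) unfolding weakly_irreducible_def by blast
  have "js \<noteq> replicate (m - 1) i" using i j by auto
  then have "?c i js < 0"
    using C_offdiag[OF js, of i] mult_pos_pos[OF l, of "A (i # js)"] A_nonneg[OF js, of i] A
    by linarith
  moreover have "?p y js < ?p x js"
    by (rule prod_list_map_strict_mono[where k = j]) (use y le j(1) lt[OF j(2)] in auto)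
  ultimately have "?c i js * ?p x js < ?c i js * ?p y js"
    by (rule mult_strict_left_mono_neg[rotated])
  then have "gap l x i < gap l y i" unfolding gap_eq_sum
    using term_le[OF i] js
    by (intro sum_strict_mono_ex1 finite_index_lists ballI bexI[of _ js]) simp_all
  then have "gap l y i \<noteq> 0" using i S(1) by simp
  then have "{i. gap l y i = 0} \<subset> S"
    using slack i unfolding y_def[symmetric]
    by (metis (mono_tags, lifting) less_irrefl mem_Collect_eq psubsetI subsetI)
  moreover have "0 \<le> gap l y i" for i
    using tight slack[of i] by (cases "i \<in> S") (auto simp: y_def less_imp_le)
  ultimately show ?thesis using y by blast
qed

text \<open>
  At the largest \<open>l\<close> a subeigenvector with the fewest tight rows has only tight rows: with none \<open>l\<close>
  could grow, and with some but not all their number could drop.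
\<close>

theorem positive_eigenpair:
  assumes n: "2 \<le> CARD('n)"
    and v: "\<And>i. 0 < v $ i" "\<And>i. 0 < tensor_apply m C v $ i"
  shows "\<exists>l x. 0 < l \<and> (\<forall>i. 0 < x $ i) \<and> (\<forall>i. gap l x i = 0)"
proof -
  obtain l0 where l0: "0 < l0" "\<And>i. 0 \<le> gap l0 v i"
    using larger_subeigenvalue_if_gap_pos[of 0 v] v(2) by (auto simp: gap_def)
  obtain l x where l: "l0 \<le> l" and x: "\<And>i. 0 < x $ i" "\<And>i. 0 \<le> gap l x i"
    and max: "\<And>l' y. \<lbrakk>\<And>i. 0 < y $ i; \<And>i. 0 \<le> gap l' y i\<rbrakk> \<Longrightarrow> l' \<le> l"
    using largest_subeigenvalue_attained[OF n l0(1) v(1) l0(2)] by blast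
  let ?P = "\<lambda>y. (\<forall>i. 0 < y $ i) \<and> (\<forall>i. 0 \<le> gap l y i)"
  let ?f = "\<lambda>y. card {i. gap l y i = 0}"
  have "?P x" using x by blast
  then obtain y where y: "?P y" and min: "\<And>z. ?P z \<Longrightarrow> ?f y \<le> ?f z"
    using ex_has_least_nat[of ?P x ?f] by blast
  let ?S = "{i. gap l y i = 0}"
  have "?S \<noteq> {}"
  proof
    assume "?S = {}"
    then have "0 < gap l y i" for i using y by (simp add: order.strict_iff_order)
    then obtain l' where "l < l'" "\<forall>i. 0 \<le> gap l' y i"
      using larger_subeigenvalue_if_gap_pos by blast
    then show False using max[of y l'] y by auto
  qed
  moreover have "\<not> ?f z < ?f y" if "?P z" for z using min[OF that] by simp
  ultimately have "?S = UNIV"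
    using fewer_tight_rows[of l y ?S] y l l0(1)
    by (smt (verit, best) finite psubset_card_mono)
  then show ?thesis using y l l0(1) by (intro exI[of _ l] exI[of _ y]) auto
qed

end

section \<open>Generalized M-tensor pairs\<close>

theorem theorem2p1:
  fixes A B :: "('n::finite) tensor" and m :: nat
  assumes "2 \<le> m" and "2 \<le> CARD('n)"
    and "A \<in> tensors m" and "B \<in> tensors m"
    and "generalized_M_tensor_pair m A B"
  shows "\<exists>s x. 0 < s \<and> (\<forall>i. 0 < x $ i) \<and>
           tensor_apply m A x = s *\<^sub>R tensor_apply m (B - A) x"
proof -
  note pair = assms(5)[unfolded generalized_M_tensor_pair_def]
  interpret nonneg_Z_pair m A "B - A"
  proof
    show "0 \<le> A (i # js)" if "length js = m - 1" for i js
      using pair that assms(1) by auto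
  qed (use pair in auto)
  obtain v where "\<And>i. 0 < v $ i" "\<And>i. 0 < tensor_apply m (B - A) v $ i"
    using pair by (auto simp: tensor_apply_diff)
  then obtain l x where l: "0 < l" and x: "\<forall>i. 0 < x $ i" and "\<forall>i. gap l x i = 0"
    using positive_eigenpair[OF assms(2)] by blast
  then have "tensor_apply m A x = (1 / l) *\<^sub>R tensor_apply m (B - A) x"
    by (simp add: gap_def vec_eq_iff)
  then show ?thesis using l x by (intro exI[of _ "1 / l"] exI[of _ x]) auto
qed

end
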